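(* Let $\Bbbk$ be a field of characteristic $0$ and $V$ an $n$-dimensional $\Bbbk$-vector space, and write $V^{2,1}=\mathrm{Hom}(V^{\otimes 2},V)$, $V^{3,1}=\mathrm{Hom}(V^{\otimes 3},V)$. The space $Q_{\mathrm{As}}^{\mathrm{sym}}$ is a $\mathrm{GL}(V)$-subrepresentation of $\mathrm{Sym}^2((V^{2,1})^\vee)$ under the natural $\mathrm{GL}(V)$-action on $V^{2,1}$ and $V^{3,1}$.
   Context: Fix a basis $(e_i)_{i=1}^n$ of $V$. Each $x\in V^{2,1}\cong\Bbbk^{n^3}$ has structure constants $x_{i,j}^\ell$ and determines the bilinear product $\mu_x(e_i,e_j)=\sum_\ell x_{i,j}^\ell e_\ell$. The group $\mathrm{GL}(V)$ acts by transport of structure: $(g\cdot\mu)(a,b)=g\,\mu(g^{-1}a,g^{-1}b)$ on $V^{2,1}$, and by the analogous formula on $V^{3,1}$; duals carry the induced action. Define $\beta:V^{2,1}\times V^{2,1}\to V^{3,1}$ by $\beta(x,y)(a,b,c)=\mu_x(\mu_y(a,b),c)-\mu_x(a,\mu_y(b,c))$. For $\varphi\in (V^{3,1})^\vee$ let $q_\varphi$ be the $n^3\times n^3$ matrix with $\langle\varphi,\beta(x,y)\rangle=x^{t}q_\varphi y$ for all $x,y$, viewed as column vectors of structure constants. Let $Q_{\mathrm{As}}$ be the linear span of all $q_\varphi$ and $Q_{\mathrm{As}}^{\mathrm{sym}}=\mathrm{span}\{\tfrac12(q+q^{t}):q\in Q_{\mathrm{As}}\}$. Symmetric $n^3\times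 n^3$ matrices $q$ are identified with quadratic forms $x\mapsto x^tqx$ on $V^{2,1}$, that is, with elements of $\mathrm{Sym}^2((V^{2,1})^\vee)$. *)

theory Defs
  imports Complex_Main "HOL-Library.Function_Algebras"
begin

(* V is the whole type 'v, with scalar multiplication s and a finite basis B as in the locale
   finite_dimensional_vector_space; n = card B, and B itself serves as index set of the basis.
   Multilinear maps, matrices and forms are functions with pointwise addition. Where only the
   values on a carrier are meant, a function is required to vanish outside the carrier, so that
   equality of functions is equality of the objects they represent. *)

type_synonym 'v op2 = "'v \<Rightarrow> 'v \<Rightarrow> 'v"
type_synonym 'v op3 = "'v \<Rightarrow> 'v \<Rightarrow> 'v \<Rightarrow> 'v"
type_synonym 'v idx = "'v \<times> 'v \<times> 'v"
type_synonym ('v, 'k) sqmat = "'v idx \<Rightarrow> 'v idx \<Rightarrow> 'k"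
type_synonym ('v, 'k) form = "'v op2 \<Rightarrow> 'k"

definition GL :: "('k::field \<Rightarrow> 'v::ab_group_add \<Rightarrow> 'v) \<Rightarrow> ('v \<Rightarrow> 'v) set" where
  "GL s = {g. Vector_Spaces.linear s s g \<and> bij g}"

(* Hom(V^{\<otimes>2}, V) and Hom(V^{\<otimes>3}, V) as bilinear and trilinear maps *)

definition V21 :: "('k::field \<Rightarrow> 'v::ab_group_add \<Rightarrow> 'v) \<Rightarrow> 'v op2 set" where
  "V21 s = {\<mu>. (\<forall>a. Vector_Spaces.linear s s (\<lambda>b. \<mu> a b)) \<and>
                (\<forall>b. Vector_Spaces.linear s s (\<lambda>a. \<mu> a b))}"

definition V31 :: "('k::field \<Rightarrow> 'v::ab_group_add \<Rightarrow> 'v) \<Rightarrow> 'v op3 set" where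
  "V31 s = {\<tau>. (\<forall>a b. Vector_Spaces.linear s s (\<lambda>c. \<tau> a b c)) \<and>
                (\<forall>a c. Vector_Spaces.linear s s (\<lambda>b. \<tau> a b c)) \<and>
                (\<forall>b c. Vector_Spaces.linear s s (\<lambda>a. \<tau> a b c))}"

definition dual_V31 ::
    "('k::field \<Rightarrow> 'v::ab_group_add \<Rightarrow> 'v) \<Rightarrow> ('v op3 \<Rightarrow> 'k) set" where
  "dual_V31 s = {\<phi>.
     (\<forall>\<sigma>\<in>V31 s. \<forall>\<tau>\<in>V31 s. \<phi> (\<lambda>a b c. \<sigma> a b c + \<tau> a b c) = \<phi> \<sigma> + \<phi> \<tau>) \<and>
     (\<forall>r. \<forall>\<tau>\<in>V31 s. \<phi> (\<lambda>a b c. s r (\<tau> a b c)) = r * \<phi> \<tau>) \<and>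
     (\<forall>\<tau>. \<tau> \<notin> V31 s \<longrightarrow> \<phi> \<tau> = 0)}"

definition beta :: "'v::ab_group_add op2 \<Rightarrow> 'v op2 \<Rightarrow> 'v op3" where
  "beta x y = (\<lambda>a b c. x (y a b) c - x a (y b c))"

(* Component (i, j, l) is the structure constant x_{i,j}^l: the e_l-coordinate of x(e_i, e_j). *)
definition struct_const ::
    "('k::field \<Rightarrow> 'v::ab_group_add \<Rightarrow> 'v) \<Rightarrow> 'v set \<Rightarrow> 'v op2 \<Rightarrow> 'v idx \<Rightarrow> 'k" where
  "struct_const s B x = (\<lambda>(i, j, l). module.representation s B (x i j) l)"

definition idxs :: "'v set \<Rightarrow> 'v idx set" where
  "idxs B = B \<times> B \<times> B"

definition sqmats :: "'v set \<Rightarrow> ('v, 'k::field) sqmat set" where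
  "sqmats B = {q. \<forall>t u. t \<notin> idxs B \<or> u \<notin> idxs B \<longrightarrow> q t u = 0}"

definition mat_transpose :: "('v, 'k) sqmat \<Rightarrow> ('v, 'k) sqmat" where
  "mat_transpose q = (\<lambda>t u. q u t)"

(* x^t q y on column vectors of structure constants *)
definition mat_pair ::
    "('k::field \<Rightarrow> 'v::ab_group_add \<Rightarrow> 'v) \<Rightarrow> 'v set \<Rightarrow> ('v, 'k) sqmat \<Rightarrow> 'v op2 \<Rightarrow> 'v op2 \<Rightarrow> 'k"
  where
  "mat_pair s B q x y =
     (\<Sum>t\<in>idxs B. \<Sum>u\<in>idxs B. struct_const s B x t * q t u * struct_const s B y u)"

(* q = q_\<phi>. The matrix is determined by \<phi>, since every column vector occurs as the
   structure constants of some element of V21. *)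
definition is_q_of ::
    "('k::field \<Rightarrow> 'v::ab_group_add \<Rightarrow> 'v) \<Rightarrow> 'v set \<Rightarrow> ('v op3 \<Rightarrow> 'k) \<Rightarrow> ('v, 'k) sqmat \<Rightarrow> bool"
  where
  "is_q_of s B \<phi> q \<longleftrightarrow>
     q \<in> sqmats B \<and> (\<forall>x\<in>V21 s. \<forall>y\<in>V21 s. \<phi> (beta x y) = mat_pair s B q x y)"

definition mat_scale :: "'k::field \<Rightarrow> ('v, 'k) sqmat \<Rightarrow> ('v, 'k) sqmat" where
  "mat_scale r q = (\<lambda>t u. r * q t u)"

definition form_scale :: "'k::field \<Rightarrow> ('v, 'k) form \<Rightarrow> ('v, 'k) form" where
  "form_scale r F = (\<lambda>x. r * F x)"

global_interpretation mat: vector_space "mat_scale :: 'k::field \<Rightarrow> ('v, 'k) sqmat \<Rightarrow> ('v, 'k) sqmat"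
  by unfold_locales (simp_all add: mat_scale_def fun_eq_iff algebra_simps)

global_interpretation form: vector_space "form_scale :: 'k::field \<Rightarrow> ('v, 'k) form \<Rightarrow> ('v, 'k) form"
  by unfold_locales (simp_all add: form_scale_def fun_eq_iff algebra_simps)

definition Q_As ::
    "('k::field \<Rightarrow> 'v::ab_group_add \<Rightarrow> 'v) \<Rightarrow> 'v set \<Rightarrow> ('v, 'k) sqmat set" where
  "Q_As s B = mat.span {q. \<exists>\<phi>\<in>dual_V31 s. is_q_of s B \<phi> q}"

definition Q_As_sym ::
    "('k::field \<Rightarrow> 'v::ab_group_add \<Rightarrow> 'v) \<Rightarrow> 'v set \<Rightarrow> ('v, 'k) sqmat set" where
  "Q_As_sym s B = mat.span {mat_scale (1/2) (q + mat_transpose q) | q. q \<in> Q_As s B}"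

(* The quadratic form x \<mapsto> x^t q x on V21 *)
definition quad_form ::
    "('k::field \<Rightarrow> 'v::ab_group_add \<Rightarrow> 'v) \<Rightarrow> 'v set \<Rightarrow> ('v, 'k) sqmat \<Rightarrow> ('v, 'k) form" where
  "quad_form s B q = (\<lambda>x. if x \<in> V21 s then mat_pair s B q x x else 0)"

(* Sym^2 of the dual of V21, as the space of quadratic forms on V21 *)
definition Sym2_dual_V21 ::
    "('k::field \<Rightarrow> 'v::ab_group_add \<Rightarrow> 'v) \<Rightarrow> 'v set \<Rightarrow> ('v, 'k) form set" where
  "Sym2_dual_V21 s B = quad_form s B ` {q \<in> sqmats B. mat_transpose q = q}"

definition act_V21 :: "('v \<Rightarrow> 'v) \<Rightarrow> 'v op2 \<Rightarrow> 'v op2" where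
  "act_V21 g \<mu> = (\<lambda>a b. g (\<mu> (inv g a) (inv g b)))"

(* Induced action on functions on V21; on a product of two linear forms it is the product of
   the transformed forms, so on quadratic forms it is the action on Sym^2 of the dual. *)
definition act_form :: "('v \<Rightarrow> 'v) \<Rightarrow> ('v, 'k) form \<Rightarrow> ('v, 'k) form" where
  "act_form g F = (\<lambda>x. F (act_V21 (inv g) x))"

(* U is a linear representation of GL(V), where sw is the scalar multiplication around U *)
definition GL_representation ::
    "('k::field \<Rightarrow> 'v::ab_group_add \<Rightarrow> 'v) \<Rightarrow> ('k \<Rightarrow> 'w::ab_group_add \<Rightarrow> 'w) \<Rightarrow>
     (('v \<Rightarrow> 'v) \<Rightarrow> 'w \<Rightarrow> 'w) \<Rightarrow> 'w set \<Rightarrow> bool" where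
  "GL_representation s sw act U \<longleftrightarrow>
     module.subspace sw U \<and>
     (\<forall>g\<in>GL s. (\<forall>u\<in>U. act g u \<in> U) \<and>
        (\<forall>u\<in>U. \<forall>w\<in>U. act g (u + w) = act g u + act g w) \<and>
        (\<forall>r. \<forall>u\<in>U. act g (sw r u) = sw r (act g u))) \<and>
     (\<forall>u\<in>U. act id u = u) \<and>
     (\<forall>g\<in>GL s. \<forall>h\<in>GL s. \<forall>u\<in>U. act (g \<circ> h) u = act g (act h u))"

definition GL_subrepresentation ::
    "('k::field \<Rightarrow> 'v::ab_group_add \<Rightarrow> 'v) \<Rightarrow> ('k \<Rightarrow> 'w::ab_group_add \<Rightarrow> 'w) \<Rightarrow>
     (('v \<Rightarrow> 'v) \<Rightarrow> 'w \<Rightarrow> 'w) \<Rightarrow> 'w set \<Rightarrow> 'w set \<Rightarrow> bool" where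
  "GL_subrepresentation s sw act W U \<longleftrightarrow>
     GL_representation s sw act U \<and> module.subspace sw W \<and> W \<subseteq> U \<and>
     (\<forall>g\<in>GL s. \<forall>w\<in>W. act g w \<in> W)"

end

(* A matrix and its symmetrization define the same quadratic form, so the forms of Q_As^sym are
   spanned by the forms x |-> phi(beta(x, x)) for phi in the dual of V31. As beta is equivariant,
   g carries such a form to the one of phi o g^-1; that this functional again has a matrix
   holds because every bilinear form on V21 is given by a matrix. *)

theory Submission
  imports Defs
begin

lemma sum_fun_apply: "(\<Sum>t\<in>T. f t) a = (\<Sum>t\<in>T. f t a)"
  by (induction T rule: infinite_finite_induct) auto

context vector_space
begin

text \<open>A version of linearity over sums for functions that are linear only on a subspace. It
  suffices because all partial sums stay in that subspace.\<close>

lemma sum_linear_on_subspace: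
  assumes "subspace S"
    and add: "\<And>x y. x \<in> S \<Longrightarrow> y \<in> S \<Longrightarrow> f (x + y) = f x + f y"
    and hom: "\<And>r x. x \<in> S \<Longrightarrow> f (scale r x) = r * f x"
    and "\<And>t. t \<in> T \<Longrightarrow> e t \<in> S"
  shows "f (\<Sum>t\<in>T. scale (r t) (e t)) = (\<Sum>t\<in>T. r t * f (e t))"
  using assms(4)
proof (induction T rule: infinite_finite_induct)
  case (insert t T)
  then have "(\<Sum>t\<in>T. scale (r t) (e t)) \<in> S" "scale (r t) (e t) \<in> S"
    using \<open>subspace S\<close> by (auto intro: subspace_sum subspace_scale)
  with insert show ?case by (simp add: add hom)
\<comment> \<open>Empty and infinite index sets both give the sum 0, and homogeneity with the scalar
  0 yields \<open>f 0 = 0\<close>.\<close>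
qed (use hom[OF subspace_0[OF \<open>subspace S\<close>], of 0] in simp_all)

end

definition op2_scale :: "('k::field \<Rightarrow> 'v::ab_group_add \<Rightarrow> 'v) \<Rightarrow> 'k \<Rightarrow> 'v op2 \<Rightarrow> 'v op2" where
  "op2_scale s r x = (\<lambda>a b. s r (x a b))"

text \<open>The conditions are relative to \<open>V21\<close> because an element of
  \<open>dual_V31\<close> is linear only on \<open>V31\<close>: for operations that are not
  bilinear, \<open>beta x y\<close> may leave \<open>V31\<close>.\<close>

definition bilinear_on_V21 ::
    "('k::field \<Rightarrow> 'v::ab_group_add \<Rightarrow> 'v) \<Rightarrow> ('v op2 \<Rightarrow> 'v op2 \<Rightarrow> 'k) \<Rightarrow> bool" where
  "bilinear_on_V21 s b \<longleftrightarrow>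
     (\<forall>x\<in>V21 s. \<forall>x'\<in>V21 s. \<forall>y\<in>V21 s.
        b (x + x') y = b x y + b x' y \<and> b y (x + x') = b y x + b y x') \<and>
     (\<forall>r. \<forall>x\<in>V21 s. \<forall>y\<in>V21 s.
        b (op2_scale s r x) y = r * b x y \<and> b x (op2_scale s r y) = r * b x y)"

definition act_V31 :: "('v \<Rightarrow> 'v) \<Rightarrow> 'v op3 \<Rightarrow> 'v op3" where
  "act_V31 g \<tau> = (\<lambda>a b c. g (\<tau> (inv g a) (inv g b) (inv g c)))"

text \<open>For a triple of basis vectors this is the tensor of the dual vectors of i and j with the
  vector l: its structure constant is 1 at (i, j, l) and 0 elsewhere.\<close>

definition elem_op ::
    "('k::field \<Rightarrow> 'v::ab_group_add \<Rightarrow> 'v) \<Rightarrow> 'v set \<Rightarrow> 'v idx \<Rightarrow> 'v op2" where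
  "elem_op s B = (\<lambda>(i, j, l) a b.
     s (module.representation s B a i * module.representation s B b j) l)"

section \<open>Multilinear maps, \<open>beta\<close> and the action of GL(V)\<close>

context vector_space
begin

lemma linear_self_iff:
  "Vector_Spaces.linear scale scale f \<longleftrightarrow>
     (\<forall>a b. f (a + b) = f a + f b) \<and> (\<forall>r a. f (scale r a) = scale r (f a))"
  by (simp add: Vector_Spaces.linear_iff vector_space_axioms)

lemma V21_iff:
  "\<mu> \<in> V21 scale \<longleftrightarrow>
     (\<forall>a b c. \<mu> (a + b) c = \<mu> a c + \<mu> b c \<and> \<mu> c (a + b) = \<mu> c a + \<mu> c b) \<and>
     (\<forall>r a b. \<mu> (scale r a) b = scale r (\<mu> a b) \<and> \<mu> a (scale r b) = scale r (\<mu> a b))"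
  unfolding V21_def linear_self_iff by blast

lemma V31_iff:
  "\<tau> \<in> V31 scale \<longleftrightarrow>
     (\<forall>a a' b c. \<tau> (a + a') b c = \<tau> a b c + \<tau> a' b c \<and> \<tau> b (a + a') c = \<tau> b a c + \<tau> b a' c \<and>
        \<tau> b c (a + a') = \<tau> b c a + \<tau> b c a') \<and>
     (\<forall>r a b c. \<tau> (scale r a) b c = scale r (\<tau> a b c) \<and> \<tau> a (scale r b) c = scale r (\<tau> a b c) \<and>
        \<tau> a b (scale r c) = scale r (\<tau> a b c))"
  unfolding V31_def linear_self_iff by blast

lemma vector_space_op2: "vector_space (op2_scale scale)"
  by unfold_locales (simp_all add: op2_scale_def fun_eq_iff algebra_simps)

lemma subspace_V21: "module.subspace (op2_scale scale) (V21 scale)"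
proof -
  interpret op2: vector_space "op2_scale scale" by (rule vector_space_op2)
  show ?thesis
    by (rule op2.subspaceI)
      (auto simp: V21_iff op2_scale_def algebra_simps)
qed

lemma beta_in_V31: "x \<in> V21 scale \<Longrightarrow> y \<in> V21 scale \<Longrightarrow> beta x y \<in> V31 scale"
  unfolding V31_iff V21_iff beta_def by (simp add: algebra_simps)

lemma V31_add: "\<sigma> \<in> V31 scale \<Longrightarrow> \<tau> \<in> V31 scale \<Longrightarrow> (\<lambda>a b c. \<sigma> a b c + \<tau> a b c) \<in> V31 scale"
  unfolding V31_iff by (simp add: algebra_simps)

lemma V31_scale: "\<tau> \<in> V31 scale \<Longrightarrow> (\<lambda>a b c. scale r (\<tau> a b c)) \<in> V31 scale"
  unfolding V31_iff by (simp add: algebra_simps)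

text \<open>\<open>beta\<close> is bilinear with values in \<open>V31\<close>, where \<phi> is
  linear.\<close>

lemma bilinear_on_V21_beta:
  assumes "\<phi> \<in> dual_V31 scale"
  shows "bilinear_on_V21 scale (\<lambda>x y. \<phi> (beta x y))"
proof -
  have add: "\<phi> (\<lambda>a b c. \<sigma> a b c + \<tau> a b c) = \<phi> \<sigma> + \<phi> \<tau>"
    if "\<sigma> \<in> V31 scale" "\<tau> \<in> V31 scale" for \<sigma> \<tau>
    using assms that by (simp add: dual_V31_def)
  have hom: "\<phi> (\<lambda>a b c. scale r (\<tau> a b c)) = r * \<phi> \<tau>" if "\<tau> \<in> V31 scale" for r \<tau>
    using assms that by (simp add: dual_V31_def)
  \<comment> \<open>In the first slot linearity is immediate from the pointwise operations. In the
    second slot the sum or multiple sits inside the outer product, which therefore has to be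
    bilinear itself.\<close>
  have "beta (x + x') y = (\<lambda>a b c. beta x y a b c + beta x' y a b c)"
    "beta y (x + x') = (\<lambda>a b c. beta y x a b c + beta y x' a b c)"
    if "y \<in> V21 scale" for x x' y
    using that by (simp_all add: V21_iff beta_def fun_eq_iff algebra_simps)
  moreover have "beta (op2_scale scale r x) y = (\<lambda>a b c. scale r (beta x y a b c))"
    "beta x (op2_scale scale r y) = (\<lambda>a b c. scale r (beta x y a b c))"
    if "x \<in> V21 scale" for x y r
    using that by (simp_all add: V21_iff beta_def op2_scale_def fun_eq_iff algebra_simps)
  ultimately show ?thesis
    by (simp add: bilinear_on_V21_def add hom beta_in_V31)
qed

lemma GL_inv:
  assumes "g \<in> GL scale"
  shows "inv g \<in> GL scale"
proof -
  have g: "bij g" "\<And>a b. g (a + b) = g a + g b" "\<And>r a. g (scale r a) = scale r (g a)"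
    using assms by (auto simp: GL_def linear_self_iff)
  have eq: "inv g u = v" if "u = g v" for u v
    using that g(1) by (simp add: bij_is_inj)
  have "inv g (a + b) = inv g a + inv g b" "inv g (scale r a) = scale r (inv g a)" for a b r
    by (rule eq, simp add: g bij_is_surj surj_f_inv_f)+
  then show ?thesis
    using g(1) by (simp add: GL_def linear_self_iff bij_imp_bij_inv)
qed

lemma act_V21_closed:
  assumes "g \<in> GL scale" "x \<in> V21 scale"
  shows "act_V21 g x \<in> V21 scale"
  using assms GL_inv[OF assms(1)] unfolding act_V21_def V21_iff GL_def linear_self_iff by simp

lemma act_V21_inv:
  assumes "g \<in> GL scale"
  shows "act_V21 g (act_V21 (inv g) x) = x"
  using assms by (simp add: act_V21_def GL_def inv_inv_eq bij_is_surj surj_f_inv_f)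

text \<open>Needed because \<open>quad_form\<close> is 0 outside \<open>V21\<close>: after transport
  by g the same case of its definition must apply. Acting by g undoes the transport and gives the
  forward direction.\<close>

lemma act_V21_inv_iff:
  assumes "g \<in> GL scale"
  shows "act_V21 (inv g) x \<in> V21 scale \<longleftrightarrow> x \<in> V21 scale"
  using act_V21_closed[OF assms] act_V21_closed[OF GL_inv[OF assms]] act_V21_inv[OF assms] by metis

lemma act_V21_add: "g \<in> GL scale \<Longrightarrow> act_V21 g (x + y) = act_V21 g x + act_V21 g y"
  by (simp add: GL_def linear_self_iff act_V21_def fun_eq_iff)

lemma act_V21_scale:
  "g \<in> GL scale \<Longrightarrow> act_V21 g (op2_scale scale r x) = op2_scale scale r (act_V21 g x)"
  by (simp add: GL_def linear_self_iff act_V21_def op2_scale_def fun_eq_iff)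

lemma bilinear_on_V21_act:
  assumes "g \<in> GL scale" "bilinear_on_V21 scale b"
  shows "bilinear_on_V21 scale (\<lambda>x y. b (act_V21 g x) (act_V21 g y))"
  using assms by (simp add: bilinear_on_V21_def act_V21_add act_V21_scale act_V21_closed)

text \<open>Equivariance of \<open>beta\<close>: between the inner and the outer product g meets its
  inverse and cancels, and the remaining outer g is pulled out of the difference.\<close>

lemma beta_act_V21:
  assumes "g \<in> GL scale"
  shows "beta (act_V21 g x) (act_V21 g y) = act_V31 g (beta x y)"
proof -
  interpret g: Vector_Spaces.linear scale scale g
    using assms by (simp add: GL_def)
  show ?thesis
    using assms by (simp add: GL_def beta_def act_V21_def act_V31_def bij_is_inj g.diff)
qed

lemma act_V31_closed:
  assumes "g \<in> GL scale" "\<tau> \<in> V31 scale"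
  shows "act_V31 g \<tau> \<in> V31 scale"
  using assms GL_inv[OF assms(1)] unfolding act_V31_def V31_iff GL_def linear_self_iff by simp

text \<open>Pullback of a functional along g. Taken at \<open>inv g\<close> it becomes the induced
  action of g on the dual; the guard keeps the convention of vanishing outside
  \<open>V31\<close>.\<close>

lemma dual_V31_act:
  assumes "g \<in> GL scale" "\<phi> \<in> dual_V31 scale"
  shows "(\<lambda>\<tau>. if \<tau> \<in> V31 scale then \<phi> (act_V31 g \<tau>) else 0) \<in> dual_V31 scale"
proof -
  have "act_V31 g (\<lambda>a b c. \<sigma> a b c + \<tau> a b c) = (\<lambda>a b c. act_V31 g \<sigma> a b c + act_V31 g \<tau> a b c)"
    "act_V31 g (\<lambda>a b c. scale r (\<tau> a b c)) = (\<lambda>a b c. scale r (act_V31 g \<tau> a b c))" for \<sigma> \<tau> r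
    using assms(1) by (simp_all add: GL_def linear_self_iff act_V31_def)
  then show ?thesis
    using assms act_V31_closed[OF assms(1)] by (simp add: dual_V31_def V31_add V31_scale)
qed

end

section \<open>Coordinates on \<open>V21\<close> and matrices of bilinear forms\<close>

context finite_dimensional_vector_space
begin

lemma
  shows coord_add:
      "representation Basis (a + b) i = representation Basis a i + representation Basis b i"
    and coord_scale: "representation Basis (scale r a) i = r * representation Basis a i"
    and coord_sum: "(\<Sum>i\<in>Basis. scale (representation Basis a i) i) = a"
  by (simp_all add: representation_add representation_scale sum_representation_eq
      independent_Basis span_Basis finite_Basis)

lemma finite_idxs: "finite (idxs Basis)"
  by (simp add: idxs_def finite_Basis)

lemma struct_const_add:
  "struct_const scale Basis (x + y) t = struct_const scale Basis x t + struct_const scale Basis y t"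
  by (simp add: struct_const_def coord_add split: prod.split)

lemma struct_const_scale:
  "struct_const scale Basis (op2_scale scale r x) t = r * struct_const scale Basis x t"
  by (simp add: struct_const_def op2_scale_def coord_scale split: prod.split)

lemma bilinear_on_V21_mat_pair: "bilinear_on_V21 scale (mat_pair scale Basis q)"
  by (simp add: bilinear_on_V21_def mat_pair_def struct_const_add struct_const_scale
      algebra_simps sum.distrib sum_distrib_left)

lemma elem_op_in_V21: "elem_op scale Basis t \<in> V21 scale"
  by (simp add: V21_iff elem_op_def coord_add coord_scale algebra_simps split: prod.split)

text \<open>The operations \<open>elem_op\<close> span \<open>V21\<close> with the structure
  constants as coefficients. This comes from expanding both arguments in the basis, and then every
  product of two basis vectors.\<close>

lemma op2_expansion:
  assumes "x \<in> V21 scale"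
  shows "x = (\<Sum>t\<in>idxs Basis. op2_scale scale (struct_const scale Basis x t) (elem_op scale Basis t))"
proof (intro ext)
  fix a b
  let ?r = "representation Basis"
  interpret l: Vector_Spaces.linear scale scale "\<lambda>a. x a b" for b
    using assms by (simp add: V21_def)
  interpret r: Vector_Spaces.linear scale scale "x a" for a
    using assms by (simp add: V21_def)
  have "x a b = x (\<Sum>i\<in>Basis. scale (?r a i) i) (\<Sum>j\<in>Basis. scale (?r b j) j)"
    by (simp add: coord_sum)
  also have "\<dots> = (\<Sum>i\<in>Basis. scale (?r a i) (x i (\<Sum>j\<in>Basis. scale (?r b j) j)))"
    by (simp only: l.sum l.scale)
  also have "\<dots> = (\<Sum>i\<in>Basis. \<Sum>j\<in>Basis. scale (?r a i * ?r b j) (x i j))"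
    by (simp add: r.sum r.scale scale_sum_right)
  also have "\<dots> = (\<Sum>i\<in>Basis. \<Sum>j\<in>Basis. \<Sum>l\<in>Basis. scale (?r (x i j) l) (scale (?r a i * ?r b j) l))"
    by (subst coord_sum[of "x _ _", symmetric]) (simp add: scale_sum_right mult.commute)
  also have "\<dots> = (\<Sum>t\<in>idxs Basis. op2_scale scale (struct_const scale Basis x t) (elem_op scale Basis t)) a b"
    by (simp add: idxs_def sum.cartesian_product sum_fun_apply op2_scale_def struct_const_def
        elem_op_def split_def)
  finally show "x a b = (\<Sum>t\<in>idxs Basis. op2_scale scale (struct_const scale Basis x t) (elem_op scale Basis t)) a b" .
qed

text \<open>Supplies the existence of q_\<phi>, which the relation \<open>is_q_of\<close> alone does
  not assert, and the matrix of a transported form.\<close>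

lemma bilinear_on_V21_matrix:
  assumes "bilinear_on_V21 scale b"
  obtains q where "q \<in> sqmats Basis"
    "\<And>x y. x \<in> V21 scale \<Longrightarrow> y \<in> V21 scale \<Longrightarrow> b x y = mat_pair scale Basis q x y"
proof
  interpret op2: vector_space "op2_scale scale" by (rule vector_space_op2)
  let ?e = "elem_op scale Basis" and ?c = "struct_const scale Basis" and ?I = "idxs Basis"
  \<comment> \<open>The Gram matrix of b on the elementary operations, padded by 0 as
    \<open>sqmats\<close> demands.\<close>
  let ?q = "\<lambda>t u. if t \<in> ?I \<and> u \<in> ?I then b (?e t) (?e u) else 0"
  show "?q \<in> sqmats Basis" by (auto simp: sqmats_def)
  fix x y assume xy: "x \<in> V21 scale" "y \<in> V21 scale"
  have "b x y = b (\<Sum>t\<in>?I. op2_scale scale (?c x t) (?e t)) y"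
    using op2_expansion[OF xy(1)] by simp
  also have "\<dots> = (\<Sum>t\<in>?I. ?c x t * b (?e t) y)"
    using assms xy by (intro op2.sum_linear_on_subspace[OF subspace_V21, of "\<lambda>x. b x y"])
      (auto simp: bilinear_on_V21_def elem_op_in_V21)
  also have "\<dots> = (\<Sum>t\<in>?I. ?c x t * b (?e t) (\<Sum>u\<in>?I. op2_scale scale (?c y u) (?e u)))"
    using op2_expansion[OF xy(2)] by simp
  also have "\<dots> = (\<Sum>t\<in>?I. ?c x t * (\<Sum>u\<in>?I. ?c y u * b (?e t) (?e u)))"
  proof -
    have "b (?e t) (\<Sum>u\<in>?I. op2_scale scale (?c y u) (?e u)) = (\<Sum>u\<in>?I. ?c y u * b (?e t) (?e u))" for t
      using assms by (intro op2.sum_linear_on_subspace[OF subspace_V21, of "b (?e t)"])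
        (auto simp: bilinear_on_V21_def elem_op_in_V21)
    then show ?thesis by simp
  qed
  also have "\<dots> = mat_pair scale Basis ?q x y"
    by (simp add: mat_pair_def sum_distrib_left mult_ac)
  finally show "b x y = mat_pair scale Basis ?q x y" .
qed

end

section \<open>Quadratic forms and symmetrization\<close>

lemma mat_pair_transpose: "mat_pair s B (mat_transpose q) x y = mat_pair s B q y x"
  unfolding mat_pair_def mat_transpose_def by (subst sum.swap) (simp add: mult_ac)

lemma linear_quad_form: "Vector_Spaces.linear mat_scale form_scale (quad_form s B)"
  by (simp add: Vector_Spaces.linear_iff mat.vector_space_axioms form.vector_space_axioms
      quad_form_def mat_pair_def form_scale_def mat_scale_def fun_eq_iff algebra_simps
      sum.distrib sum_distrib_left)

lemma linear_act_form: "Vector_Spaces.linear form_scale form_scale (act_form g)"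
  by (simp add: Vector_Spaces.linear_iff form.vector_space_axioms act_form_def form_scale_def
      fun_eq_iff)

text \<open>On the diagonal x^t q^t x = x^t q x, so the two halves add up to the form of q;
  characteristic 0 makes 1/2 + 1/2 = 1.\<close>

lemma quad_form_symmetrize:
  fixes q :: "('v::ab_group_add, 'k::field_char_0) sqmat"
  shows "quad_form s B (mat_scale (1/2) (q + mat_transpose q)) = quad_form s B q"
proof -
  interpret Q: Vector_Spaces.linear mat_scale form_scale "quad_form s B"
    by (rule linear_quad_form)
  have "quad_form s B (mat_transpose q) = quad_form s B q"
    by (simp add: quad_form_def mat_pair_transpose fun_eq_iff)
  then show ?thesis
    by (simp add: Q.scale Q.add form_scale_def fun_eq_iff)
qed

lemma symmetrize_in_sqmats:
  "q \<in> sqmats B \<Longrightarrow> mat_scale r (q + mat_transpose q) \<in> sqmats B"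
  by (auto simp: sqmats_def mat_scale_def mat_transpose_def)

lemma mat_transpose_symmetrize:
  "mat_transpose (mat_scale r (q + mat_transpose q)) = mat_scale r (q + mat_transpose q)"
  by (simp add: mat_scale_def mat_transpose_def fun_eq_iff add.commute)

text \<open>Replacing a matrix by its symmetrization keeps the form, so membership can be shown with
  any matrix, symmetric or not.\<close>

lemma Sym2_dual_V21_eq:
  fixes s :: "'k::field_char_0 \<Rightarrow> 'v::ab_group_add \<Rightarrow> 'v"
  shows "Sym2_dual_V21 s B = quad_form s B ` sqmats B"
proof
  show "quad_form s B ` sqmats B \<subseteq> Sym2_dual_V21 s B"
  proof
    fix F assume "F \<in> quad_form s B ` sqmats B"
    then obtain q where q: "q \<in> sqmats B" "F = quad_form s B q" by blast
    then show "F \<in> Sym2_dual_V21 s B"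
      unfolding Sym2_dual_V21_def
      by (intro image_eqI[where x = "mat_scale (1/2) (q + mat_transpose q)"])
        (auto simp: quad_form_symmetrize symmetrize_in_sqmats mat_transpose_symmetrize)
  qed
qed (auto simp: Sym2_dual_V21_def)

lemma subspace_Sym2_dual_V21:
  fixes s :: "'k::field_char_0 \<Rightarrow> 'v::ab_group_add \<Rightarrow> 'v"
  shows "form.subspace (Sym2_dual_V21 s B)"
proof -
  interpret Q: Vector_Spaces.linear mat_scale form_scale "quad_form s B"
    by (rule linear_quad_form)
  have "mat.subspace (sqmats B)"
    by (rule mat.subspaceI) (auto simp: sqmats_def mat_scale_def)
  then show ?thesis
    unfolding Sym2_dual_V21_eq by (rule Q.subspace_image)
qed

text \<open>Symmetrization disappears on passing to forms. By linearity \<open>quad_form\<close>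
  commutes with both spans, and the span of a span collapses, leaving the forms of the matrices
  q_\<phi> as generators.\<close>

lemma quad_form_Q_As_sym:
  fixes s :: "'k::field_char_0 \<Rightarrow> 'v::ab_group_add \<Rightarrow> 'v"
  shows "quad_form s B ` Q_As_sym s B =
    form.span (quad_form s B ` {q. \<exists>\<phi>\<in>dual_V31 s. is_q_of s B \<phi> q})"
proof -
  interpret Q: Vector_Spaces.linear mat_scale form_scale "quad_form s B"
    by (rule linear_quad_form)
  have "quad_form s B ` {mat_scale (1/2) (q + mat_transpose q) | q. q \<in> Q_As s B}
      = quad_form s B ` Q_As s B"
    by (auto simp: image_iff quad_form_symmetrize) (metis quad_form_symmetrize)
  then show ?thesis
    unfolding Q_As_sym_def Q.span_image[symmetric]
    by (simp add: Q_As_def form.span_span flip: Q.span_image)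
qed

section \<open>The action of GL(V) on quadratic forms\<close>

context finite_dimensional_vector_space
begin

text \<open>The bilinear form of q, transported in both arguments by \<open>inv g\<close>, is again
  bilinear; its matrix represents the transformed quadratic form.\<close>

lemma act_form_Sym2:
  assumes "g \<in> GL scale" "q \<in> sqmats Basis"
  shows "act_form g (quad_form scale Basis q) \<in> quad_form scale Basis ` sqmats Basis"
proof -
  obtain q' where "q' \<in> sqmats Basis" and
    "\<And>x y. x \<in> V21 scale \<Longrightarrow> y \<in> V21 scale \<Longrightarrow>
       mat_pair scale Basis q (act_V21 (inv g) x) (act_V21 (inv g) y) = mat_pair scale Basis q' x y"
    using bilinear_on_V21_matrix[OF bilinear_on_V21_act[OF GL_inv[OF assms(1)]
          bilinear_on_V21_mat_pair[of q]]] by blast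
  then show ?thesis
    by (intro image_eqI[of _ _ q'])
      (simp_all add: act_form_def quad_form_def fun_eq_iff act_V21_inv_iff[OF assms(1)])
qed

text \<open>The generators are permuted among themselves: the form of q_\<phi> goes to the form of
  q_\<psi>, with \<psi> the image of \<phi> under the induced action on the dual.\<close>

lemma act_form_q_of:
  assumes g: "g \<in> GL scale" and \<phi>: "\<phi> \<in> dual_V31 scale" and q: "is_q_of scale Basis \<phi> q"
  obtains \<psi> p where "\<psi> \<in> dual_V31 scale" "is_q_of scale Basis \<psi> p"
    "act_form g (quad_form scale Basis q) = quad_form scale Basis p"
proof -
  note h = GL_inv[OF g]
  define \<psi> where "\<psi> = (\<lambda>\<tau>. if \<tau> \<in> V31 scale then \<phi> (act_V31 (inv g) \<tau>) else 0)"
  have \<psi>: "\<psi> \<in> dual_V31 scale"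
    unfolding \<psi>_def by (rule dual_V31_act[OF h \<phi>])
  obtain p where p: "p \<in> sqmats Basis" "\<And>x y. x \<in> V21 scale \<Longrightarrow> y \<in> V21 scale \<Longrightarrow>
      \<psi> (beta x y) = mat_pair scale Basis p x y"
    using bilinear_on_V21_matrix[OF bilinear_on_V21_beta[OF \<psi>]] by blast
  \<comment> \<open>Only the diagonal is compared, since only the quadratic forms have to
    agree.\<close>
  have "mat_pair scale Basis q (act_V21 (inv g) x) (act_V21 (inv g) x) = mat_pair scale Basis p x x"
    if x: "x \<in> V21 scale" for x
  proof -
    have "mat_pair scale Basis q (act_V21 (inv g) x) (act_V21 (inv g) x)
        = \<phi> (beta (act_V21 (inv g) x) (act_V21 (inv g) x))"
      using q act_V21_closed[OF h x] by (simp add: is_q_of_def)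
    also have "\<dots> = \<psi> (beta x x)"
      by (simp add: \<psi>_def beta_act_V21[OF h] beta_in_V31 x)
    finally show ?thesis by (simp add: p(2) x)
  qed
  then have "act_form g (quad_form scale Basis q) = quad_form scale Basis p"
    by (simp add: act_form_def quad_form_def fun_eq_iff act_V21_inv_iff[OF g])
  with \<psi> p show ?thesis by (intro that[of \<psi> p]) (auto simp: is_q_of_def)
qed

end

theorem proposition1p3:
  fixes s :: "'k::field_char_0 \<Rightarrow> 'v::ab_group_add \<Rightarrow> 'v" and B :: "'v set"
  assumes "finite_dimensional_vector_space s B"
  shows "GL_subrepresentation s form_scale act_form
           (quad_form s B ` Q_As_sym s B) (Sym2_dual_V21 s B)"
proof -
  interpret V: finite_dimensional_vector_space s B by fact
  let ?P = "{q. \<exists>\<phi>\<in>dual_V31 s. is_q_of s B \<phi> q}"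
  \<comment> \<open>Precomposition reverses the order of factors and inversion reverses it back, so
    this is a left action. It holds for all functions F, not just quadratic forms.\<close>
  have "act_form (g \<circ> h) F = act_form g (act_form h F)" if "g \<in> GL s" "h \<in> GL s"
    for g h and F :: "('v, 'k) form"
    using that by (simp add: act_form_def act_V21_def GL_def o_inv_distrib inv_inv_eq bij_comp
        bij_imp_bij_inv)
  moreover have "act_form id F = F" for F :: "('v, 'k) form"
    by (simp add: act_form_def act_V21_def)
  moreover have "act_form g F \<in> Sym2_dual_V21 s B" if "g \<in> GL s" "F \<in> Sym2_dual_V21 s B" for g F
    using that V.act_form_Sym2 unfolding Sym2_dual_V21_eq by blast
  moreover have "act_form g (F + G) = act_form g F + act_form g G"
    "act_form g (form_scale r F) = form_scale r (act_form g F)" for g r and F G :: "('v, 'k) form"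
    by (simp_all add: act_form_def form_scale_def fun_eq_iff)
  ultimately have "GL_representation s form_scale act_form (Sym2_dual_V21 s B)"
    by (simp add: GL_representation_def subspace_Sym2_dual_V21)
  moreover have "form.span (quad_form s B ` ?P) \<subseteq> Sym2_dual_V21 s B"
    by (intro form.span_minimal subspace_Sym2_dual_V21)
      (auto simp: Sym2_dual_V21_eq is_q_of_def)
  moreover have "act_form g F \<in> form.span (quad_form s B ` ?P)"
    if g: "g \<in> GL s" and F: "F \<in> form.span (quad_form s B ` ?P)" for g F
  proof -
    interpret A: Vector_Spaces.linear form_scale form_scale "act_form g"
      by (rule linear_act_form)
    \<comment> \<open>Checking generators is enough: \<open>act_form g\<close> is linear, so it maps
      their span onto the span of their images.\<close>
    have "act_form g ` quad_form s B ` ?P \<subseteq> quad_form s B ` ?P"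
    proof clarify
      fix q \<phi> assume "\<phi> \<in> dual_V31 s" "is_q_of s B \<phi> q"
      then obtain \<psi> p where "\<psi> \<in> dual_V31 s" "is_q_of s B \<psi> p"
        "act_form g (quad_form s B q) = quad_form s B p"
        by (rule V.act_form_q_of[OF g])
      then show "act_form g (quad_form s B q) \<in> quad_form s B ` ?P" by blast
    qed
    then have "form.span (act_form g ` quad_form s B ` ?P) \<subseteq> form.span (quad_form s B ` ?P)"
      by (rule form.span_mono)
    with F show ?thesis
      unfolding A.span_image by blast
  qed
  ultimately show ?thesis
    by (simp add: GL_subrepresentation_def quad_form_Q_As_sym form.subspace_span)
qed

end
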